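(* Let $p_0\in\mathbb{R}$ with $p_0\neq 0$ and let $Q,R,S\in\mathbb{H}$. Consider the equation $$p_0|X|^2 + XQ + RX^* = S \qquad (\ast)$$ in the unknown $X\in\mathbb{H}$. Set $$\rho := \frac{\mathrm{scal}(S)}{p_0}+\frac{|Q+R^*|^2}{4p_0^2}.$$ The solutions in $\mathbb{H}$ of $(\ast)$ are exactly the points $X=Y-\frac{Q^*+R}{2p_0}$, where $Y\in\mathbb{H}$ satisfies both $$|Y|^2=\rho \qquad\text{and}\qquad \mathrm{vect}\big(Y(Q-R^* )\big)=\mathrm{vect}\Big(S+\frac{RQ}{p_0}\Big).$$ In particular: 1. If $\rho<0$, then $(\ast)$ has no solution. 2. If $\rho=0$, then either $X=-\frac{Q^*+R}{2p_0}$ is the unique solution of $(\ast)$, or $(\ast)$ has no solution, depending on whether or not $S+\frac{RQ}{p_0}\in\mathbb{R}$. 3. If $\rho>0$, then: (a) if $Q=R^*$, the set of solutions of $(\ast)$ is the $3$-sphere $\big\{Y-\frac{Q^*+R}{2p_0} : Y\in\mathbb{H},\ |Y|^2=\rho\big\}$ or the empty set, depending on whether or not $S\in\mathbb{R}$; (b) if $Q\neq R^*$, there are two, one, or no solutions of $(\ast)$, namely the points $X=Y-\frac{Q^*+R}{2p_0}$ where $Y$ is a point of intersection of the $3$-sphere $\{Y\in\mathbb{H}:|Y|^2=\rho\}$ with the affine line $\{Y\in\mathbb{H}:\mathrm{vect}(Y(Q-R^* ))=\mathrm{vect}(S+RQ/p_0)\}$. Specifically, setting $$\Delta=\rho\,|Q-R^*|^2-\Big|\mathrm{vect}\Big(S+\frac{RQ}{p_0}\Big)\Big|^2,$$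 there are two, one, or no solutions according to whether $\Delta$ is positive, zero, or negative, and when $\Delta\ge 0$ the points $Y$ are $$Y=\Big[\mathrm{vect}\Big(S+\frac{RQ}{p_0}\Big)\pm\sqrt{\Delta}\,\Big](Q-R^* )^{-1}.$$
   Context: $\mathbb{H}$ denotes the skew field of real quaternions, with standard real basis $1,\mathbf{i},\mathbf{j},\mathbf{k}$, identified as a vector space with Euclidean $\mathbb{R}^4$; $\mathbb{R}\subset\mathbb{H}$ is the real axis $\mathbb{R}\cdot 1$. For $X=x_0+x_1\mathbf{i}+x_2\mathbf{j}+x_3\mathbf{k}$ with $x_0,\ldots,x_3\in\mathbb{R}$: $\mathrm{scal}(X)=x_0$ is the scalar part, $\mathrm{vect}(X)=x_1\mathbf{i}+x_2\mathbf{j}+x_3\mathbf{k}$ is the vector part, $X^*=\mathrm{scal}(X)-\mathrm{vect}(X)$ is the conjugate, and $|X|$ is the Euclidean norm, so $XX^*=X^*X=|X|^2$. *)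

theory Defs
  imports "HOL-Analysis.Analysis"
begin

datatype quat = Quat (scal: real) (im_i: real) (im_j: real) (im_k: real)

lemma quat_eq_iff:
  "x = y \<longleftrightarrow> scal x = scal y \<and> im_i x = im_i y \<and> im_j x = im_j y \<and> im_k x = im_k y"
  by (cases x; cases y) auto

instantiation quat :: ring_1
begin

definition "0 = Quat 0 0 0 0"
definition "1 = Quat 1 0 0 0"
definition "x + y = Quat (scal x + scal y) (im_i x + im_i y) (im_j x + im_j y) (im_k x + im_k y)"
definition "- x = Quat (- scal x) (- im_i x) (- im_j x) (- im_k x)"
definition "x - y = Quat (scal x - scal y) (im_i x - im_i y) (im_j x - im_j y) (im_k x - im_k y)"
definition "x * y = Quat
  (scal x * scal y - im_i x * im_i y - im_j x * im_j y - im_k x * im_k y)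
  (scal x * im_i y + im_i x * scal y + im_j x * im_k y - im_k x * im_j y)
  (scal x * im_j y - im_i x * im_k y + im_j x * scal y + im_k x * im_i y)
  (scal x * im_k y + im_i x * im_j y - im_j x * im_i y + im_k x * scal y)"

instance
  by standard
    (auto simp: zero_quat_def one_quat_def plus_quat_def uminus_quat_def minus_quat_def
      times_quat_def algebra_simps)

end

lemma quat_ring_sel [simp]:
  "scal 0 = 0" "im_i 0 = 0" "im_j 0 = 0" "im_k 0 = 0"
  "scal 1 = 1" "im_i 1 = 0" "im_j 1 = 0" "im_k 1 = 0"
  "scal (x + y) = scal x + scal y" "im_i (x + y) = im_i x + im_i y"
  "im_j (x + y) = im_j x + im_j y" "im_k (x + y) = im_k x + im_k y"
  "scal (- x) = - scal x" "im_i (- x) = - im_i x"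
  "im_j (- x) = - im_j x" "im_k (- x) = - im_k x"
  "scal (x - y) = scal x - scal y" "im_i (x - y) = im_i x - im_i y"
  "im_j (x - y) = im_j x - im_j y" "im_k (x - y) = im_k x - im_k y"
  by (auto simp: zero_quat_def one_quat_def plus_quat_def uminus_quat_def minus_quat_def)

lemma quat_mult_sel:
  "scal (x * y) = scal x * scal y - im_i x * im_i y - im_j x * im_j y - im_k x * im_k y"
  "im_i (x * y) = scal x * im_i y + im_i x * scal y + im_j x * im_k y - im_k x * im_j y"
  "im_j (x * y) = scal x * im_j y - im_i x * im_k y + im_j x * scal y + im_k x * im_i y"
  "im_k (x * y) = scal x * im_k y + im_i x * im_j y - im_j x * im_i y + im_k x * scal y"
  by (auto simp: times_quat_def)

definition quat_i :: quat where "quat_i = Quat 0 1 0 0"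
definition quat_j :: quat where "quat_j = Quat 0 0 1 0"
definition quat_k :: quat where "quat_k = Quat 0 0 0 1"

lemma quat_unit_relations:
  "quat_i * quat_i = - 1" "quat_j * quat_j = - 1" "quat_k * quat_k = - 1"
  "quat_i * quat_j = quat_k" "quat_j * quat_k = quat_i" "quat_k * quat_i = quat_j"
  "quat_j * quat_i = - quat_k" "quat_k * quat_j = - quat_i" "quat_i * quat_k = - quat_j"
  by (auto simp: quat_eq_iff quat_mult_sel quat_i_def quat_j_def quat_k_def)

instantiation quat :: real_vector
begin

definition "r *\<^sub>R x = Quat (r * scal x) (r * im_i x) (r * im_j x) (r * im_k x)"

instance
  by standard (auto simp: quat_eq_iff scaleR_quat_def algebra_simps)

end

instantiation quat :: real_inner
begin

definition "inner x y = scal x * scal y + im_i x * im_i y + im_j x * im_j y + im_k x * im_k y"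
definition "norm (x :: quat) = sqrt ((scal x)\<^sup>2 + (im_i x)\<^sup>2 + (im_j x)\<^sup>2 + (im_k x)\<^sup>2)"
definition "sgn (x :: quat) = x /\<^sub>R norm x"
definition "dist (x :: quat) y = norm (x - y)"
definition  "(uniformity :: (quat \<times> quat) filter) = (INF e\<in>{0<..}. principal {(x, y). dist x y < e})"
definition  "open (U :: quat set) \<longleftrightarrow> (\<forall>x\<in>U. eventually (\<lambda>(x', y). x' = x \<longrightarrow> y \<in> U) uniformity)"

instance
proof
  fix x y z :: quat and r s :: real
  show "dist x y = norm (x - y)" by (rule dist_quat_def)
  show "sgn x = x /\<^sub>R norm x" by (rule sgn_quat_def)
  show "uniformity = (INF e\<in>{0<..}. principal {(x :: quat, y). dist x y < e})"
    by (rule uniformity_quat_def)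
  show "open U \<longleftrightarrow> (\<forall>x\<in>U. eventually (\<lambda>(x', y). x' = x \<longrightarrow> y \<in> U) uniformity)"
    for U :: "quat set" by (rule open_quat_def)
  show "inner x y = inner y x" "inner (x + y) z = inner x z + inner y z"
    "inner (r *\<^sub>R x) y = r * inner x y" "0 \<le> inner x x"
    by (auto simp: inner_quat_def scaleR_quat_def algebra_simps)
  show "inner x x = 0 \<longleftrightarrow> x = 0"
    by (auto simp: inner_quat_def quat_eq_iff add_nonneg_eq_0_iff)
  show "norm x = sqrt (inner x x)"
    by (simp add: inner_quat_def norm_quat_def power2_eq_square)
qed

end

lemma quat_scaleR_sel [simp]:
  "scal (r *\<^sub>R x) = r * scal x" "im_i (r *\<^sub>R x) = r * im_i x"
  "im_j (r *\<^sub>R x) = r * im_j x" "im_k (r *\<^sub>R x) = r * im_k x"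
  by (auto simp: scaleR_quat_def)

lemma quat_norm_squared: "(norm x)\<^sup>2 = (scal x)\<^sup>2 + (im_i x)\<^sup>2 + (im_j x)\<^sup>2 + (im_k x)\<^sup>2"
  by (simp add: norm_quat_def)

definition qcnj :: "quat \<Rightarrow> quat" where
  "qcnj x = Quat (scal x) (- im_i x) (- im_j x) (- im_k x)"

definition vect :: "quat \<Rightarrow> quat" where
  "vect x = Quat 0 (im_i x) (im_j x) (im_k x)"

lemma qcnj_sel [simp]:
  "scal (qcnj x) = scal x" "im_i (qcnj x) = - im_i x"
  "im_j (qcnj x) = - im_j x" "im_k (qcnj x) = - im_k x"
  by (auto simp: qcnj_def)

lemma vect_sel [simp]:
  "scal (vect x) = 0" "im_i (vect x) = im_i x" "im_j (vect x) = im_j x" "im_k (vect x) = im_k x"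
  by (auto simp: vect_def)

instantiation quat :: real_normed_div_algebra
begin

definition "inverse (x :: quat) = qcnj x /\<^sub>R (norm x)\<^sup>2"
definition "x div (y :: quat) = x * inverse y"

instance
proof
  fix x y :: quat
  have cnj: "qcnj x * x = (norm x)\<^sup>2 *\<^sub>R 1" "x * qcnj x = (norm x)\<^sup>2 *\<^sub>R 1" for x :: quat
    by (auto simp: quat_eq_iff quat_mult_sel quat_norm_squared simp flip: power2_eq_square)
  have scl: "(r *\<^sub>R x) * y = r *\<^sub>R (x * y)" "x * (r *\<^sub>R y) = r *\<^sub>R (x * y)" for r and x y :: quat
    by (auto simp: quat_eq_iff quat_mult_sel algebra_simps)
  then show "r *\<^sub>R x * y = r *\<^sub>R (x * y)" "x * r *\<^sub>R y = r *\<^sub>R (x * y)" for r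
    by blast+
  show "inverse x * x = 1" "x * inverse x = 1" if "x \<noteq> 0"
    using that by (auto simp: inverse_quat_def scl cnj)
  show "x div y = x * inverse y" by (rule divide_quat_def)
  show "inverse (0 :: quat) = 0" by (auto simp: inverse_quat_def quat_eq_iff)
  have "(norm (x * y))\<^sup>2 = (norm x * norm y)\<^sup>2"
    unfolding power_mult_distrib quat_norm_squared quat_mult_sel
    by algebra
  then show "norm (x * y) = norm x * norm y"
    by (simp add: power2_eq_iff_nonneg)
qed

end

lemma quat_of_real_sel [simp]:
  "scal (of_real r) = r" "im_i (of_real r) = 0" "im_j (of_real r) = 0" "im_k (of_real r) = 0"
  by (auto simp: of_real_def)

lemma qcnj_eq: "qcnj x = of_real (scal x) - vect x"
  by (auto simp: quat_eq_iff)

lemma mult_qcnj: "x * qcnj x = of_real ((norm x)\<^sup>2)" "qcnj x * x = of_real ((norm x)\<^sup>2)"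
  by (simp_all add: quat_eq_iff quat_mult_sel quat_norm_squared del: of_real_power flip: power2_eq_square)

lemma quat_Reals_iff: "x \<in> \<real> \<longleftrightarrow> vect x = 0"
proof
  assume "vect x = 0"
  then have "x = of_real (scal x)" by (auto simp: quat_eq_iff)
  then show "x \<in> \<real>" by (metis Reals_of_real)
qed (auto simp: quat_eq_iff elim!: Reals_cases)

instantiation quat :: euclidean_space
begin

definition "Basis = {1, quat_i, quat_j, quat_k}"

instance
proof
  show "(Basis :: quat set) \<noteq> {}" "finite (Basis :: quat set)"
    by (auto simp: Basis_quat_def)
  show "inner u v = (if u = v then 1 else 0)" if "u \<in> Basis" "v \<in> Basis" for u v :: quat
    using that unfolding Basis_quat_def
    by (elim insertE emptyE)
      (simp_all add: inner_quat_def quat_i_def quat_j_def quat_k_def one_quat_def)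
  show "(\<forall>u\<in>Basis. inner x u = 0) \<longleftrightarrow> x = 0" for x :: quat
    unfolding quat_eq_iff[of x 0]
    by (simp add: Basis_quat_def inner_quat_def quat_i_def quat_j_def quat_k_def)
qed

end

lemma DIM_quat: "DIM(quat) = 4"
  by (simp add: Basis_quat_def quat_i_def quat_j_def quat_k_def quat_eq_iff)

end

theory Submission
  imports Defs
begin

text \<open>
  The equation is solved by completing the square. With \<open>C = (Q\<^sup>* + R) / (2 p\<^sub>0)\<close>, the substitution
  \<open>X = Y - C\<close> makes the symmetric parts of the linear terms \<open>X Q + R X\<^sup>*\<close> cancel against the mixed
  terms of \<open>p\<^sub>0 |Y - C|\<^sup>2\<close>. What is left of them is antisymmetric under conjugation, hence a pure
  vector, so the equation turns into
  \<open>p\<^sub>0 (|Y|\<^sup>2 - \<rho>) + vect (Y D) = vect T\<close> with \<open>D = Q - R\<^sup>*\<close>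
  (lemma \<open>complete_the_square\<close>). Its scalar part is the sphere condition \<open>|Y|\<^sup>2 = \<rho>\<close>, and its vector
  part is the linear condition \<open>vect (Y D) = vect T\<close>.

  If \<open>D = 0\<close>, the linear condition does not involve \<open>Y\<close> and only says that \<open>T\<close> is real. If \<open>D \<noteq> 0\<close>,
  it leaves exactly the scalar part \<open>t\<close> of \<open>Y D\<close> free, so that \<open>Y = (vect T + t) D\<^sup>-\<^sup>1\<close> runs through a
  line (lemma \<open>vect_mult_eq_iff\<close>). Since the norm is multiplicative and real quaternions are orthogonal
  to pure vectors, \<open>|Y|\<^sup>2 |D|\<^sup>2 = |vect T|\<^sup>2 + t\<^sup>2\<close> on this line. The sphere condition thus becomes
  \<open>t\<^sup>2 = \<Delta>\<close>, and the number of real square roots of \<open>\<Delta>\<close> is the number of solutions.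
\<close>

section \<open>Vector parts and translates\<close>

lemma vect_of_real [simp]: "vect (of_real t) = 0"
  by (simp add: quat_eq_iff)

lemma vect_add: "vect (x + y) = vect x + vect y"
  by (simp add: quat_eq_iff)

lemma vect_vect [simp]: "vect (vect x) = vect x"
  by (simp add: quat_eq_iff)

lemma mem_translate_iff:
  fixes c :: "'a :: group_add"
  shows "x \<in> {y - c | y. P y} \<longleftrightarrow> P (x + c)"
proof
  assume "P (x + c)"
  moreover have "x = (x + c) - c"
    by simp
  ultimately show "x \<in> {y - c | y. P y}"
    by blast
qed auto

lemma norm_vect_add_of_real: "(norm (vect v + of_real t))\<^sup>2 = (norm (vect v))\<^sup>2 + t\<^sup>2"
  by (simp add: quat_norm_squared)

section \<open>Completing the square\<close>

text \<open>
  Expressing \<open>Q\<close> through the centre \<open>C\<close> keeps \<open>p\<^sub>0\<close> out of the denominators, which makes the completed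
  square a polynomial identity in the coordinates.
\<close>

lemma complete_the_square_polynomial:
  fixes Y C R :: quat and p :: real
  defines "Q \<equiv> (2 * p) *\<^sub>R qcnj C - qcnj R"
  shows "of_real (p * (norm (Y - C))\<^sup>2) + (Y - C) * Q + R * qcnj (Y - C)
    = of_real (p * (norm Y)\<^sup>2 - p * (norm C)\<^sup>2) + vect (Y * (Q - qcnj R)) - 2 *\<^sub>R vect (R * qcnj C)"
  unfolding Q_def quat_eq_iff
  by (simp add: quat_mult_sel quat_norm_squared del: of_real_mult of_real_diff of_real_power)
    (simp add: algebra_simps power2_eq_square)

lemma complete_the_square:
  fixes p :: real and Q R S Y :: quat
  assumes "p \<noteq> 0"
  defines "\<rho> \<equiv> scal S / p + (norm (Q + qcnj R))\<^sup>2 / (4 * p\<^sup>2)"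
    and "C \<equiv> (qcnj Q + R) /\<^sub>R (2 * p)"
    and "T \<equiv> S + (R * Q) /\<^sub>R p"
  shows "of_real (p * (norm (Y - C))\<^sup>2) + (Y - C) * Q + R * qcnj (Y - C) - S
    = of_real (p * ((norm Y)\<^sup>2 - \<rho>)) + (vect (Y * (Q - qcnj R)) - vect T)"
proof -
  have Q: "Q = (2 * p) *\<^sub>R qcnj C - qcnj R"
    using \<open>p \<noteq> 0\<close> by (simp add: C_def quat_eq_iff field_simps)
  have "Q + qcnj R = (2 * p) *\<^sub>R qcnj C"
    using Q by simp
  then have "(norm (Q + qcnj R))\<^sup>2 = 4 * p\<^sup>2 * (norm C)\<^sup>2"
    by (simp add: quat_norm_squared algebra_simps power_mult_distrib)
  then have \<rho>: "p * \<rho> = scal S + p * (norm C)\<^sup>2"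
    using \<open>p \<noteq> 0\<close> by (simp add: \<rho>_def field_simps)
  \<comment> \<open>The summand \<open>|R|\<^sup>2\<close> is real, so it does not contribute to the vector part of \<open>T\<close>.\<close>
  have "R * Q = (2 * p) *\<^sub>R (R * qcnj C) - of_real ((norm R)\<^sup>2)"
    by (subst Q) (simp add: algebra_simps mult_qcnj)
  then have T: "vect T = vect S + 2 *\<^sub>R vect (R * qcnj C)"
    using \<open>p \<noteq> 0\<close> by (simp add: T_def quat_eq_iff field_simps del: of_real_power)
  have S: "S = of_real (scal S) + vect S"
    by (simp add: quat_eq_iff)
  have "of_real (p * (norm (Y - C))\<^sup>2) + (Y - C) * Q + R * qcnj (Y - C)
      = of_real (p * (norm Y)\<^sup>2 - p * (norm C)\<^sup>2) + vect (Y * (Q - qcnj R)) - 2 *\<^sub>R vect (R * qcnj C)"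
    using complete_the_square_polynomial[of p Y C R] Q by simp
  moreover have "p * ((norm Y)\<^sup>2 - \<rho>) = p * (norm Y)\<^sup>2 - p * (norm C)\<^sup>2 - scal S"
    using \<rho> by (simp add: algebra_simps)
  ultimately show ?thesis
    using T S by (simp add: algebra_simps quat_eq_iff del: of_real_mult of_real_diff of_real_power)
qed

text \<open>
  The two summands of the completed square lie in complementary subspaces, so that they vanish together
  only if each of them does.
\<close>

lemma solution_iff:
  fixes p :: real and Q R S Y :: quat
  assumes "p \<noteq> 0"
  defines "\<rho> \<equiv> scal S / p + (norm (Q + qcnj R))\<^sup>2 / (4 * p\<^sup>2)"
    and "C \<equiv> (qcnj Q + R) /\<^sub>R (2 * p)"
    and "T \<equiv> S + (R * Q) /\<^sub>R p"
  shows "of_real (p * (norm (Y - C))\<^sup>2) + (Y - C) * Q + R * qcnj (Y - C) = S \<longleftrightarrow>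
    (norm Y)\<^sup>2 = \<rho> \<and> vect (Y * (Q - qcnj R)) = vect T"
proof -
  have split: "of_real r + (vect x - vect y) = 0 \<longleftrightarrow> r = 0 \<and> vect x = vect y" for r x y
    by (auto simp: quat_eq_iff)
  have "of_real (p * (norm (Y - C))\<^sup>2) + (Y - C) * Q + R * qcnj (Y - C) = S \<longleftrightarrow>
      of_real (p * (norm (Y - C))\<^sup>2) + (Y - C) * Q + R * qcnj (Y - C) - S = 0"
    by simp
  also have "\<dots> \<longleftrightarrow> p * ((norm Y)\<^sup>2 - \<rho>) = 0 \<and> vect (Y * (Q - qcnj R)) = vect T"
    unfolding complete_the_square[OF \<open>p \<noteq> 0\<close>, of Y Q R S, folded \<rho>_def C_def T_def] by (rule split)
  finally show ?thesis
    using \<open>p \<noteq> 0\<close> by simp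
qed

section \<open>The line cut out by the vector part, and its intersection with spheres\<close>

text \<open>
  The parameter \<open>t\<close> is the scalar part of \<open>Y D\<close>, the one coordinate of \<open>Y D\<close> that prescribing its
  vector part leaves free.
\<close>

lemma vect_mult_eq_iff:
  fixes D :: quat
  assumes "D \<noteq> 0"
  shows "vect (Y * D) = vect V \<longleftrightarrow> (\<exists>t. Y = (vect V + of_real t) * inverse D)"
proof
  assume "vect (Y * D) = vect V"
  then have "Y * D = vect V + of_real (scal (Y * D))"
    by (simp add: quat_eq_iff)
  then have "Y = (vect V + of_real (scal (Y * D))) * inverse D"
    using assms by (metis mult.assoc mult.right_neutral right_inverse)
  then show "\<exists>t. Y = (vect V + of_real t) * inverse D" ..
next
  assume "\<exists>t. Y = (vect V + of_real t) * inverse D"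
  then show "vect (Y * D) = vect V"
    using assms by (auto simp: mult.assoc vect_add)
qed

lemma vect_mult_line:
  fixes D V :: quat
  assumes "D \<noteq> 0"
  shows "affine {Y. vect (Y * D) = vect V} \<and> aff_dim {Y. vect (Y * D) = vect V} = 1"
proof -
  define a where "a = vect V * inverse D"
  \<comment> \<open>The line has direction \<open>D\<^sup>-\<^sup>1\<close>, so \<open>a\<close> and \<open>a + D\<^sup>-\<^sup>1\<close> are two distinct points that span it.\<close>
  have "{Y. vect (Y * D) = vect V} = range (\<lambda>t. a + t *\<^sub>R ((a + inverse D) - a))"
    using vect_mult_eq_iff[OF assms]
    by (auto simp: a_def distrib_right scaleR_conv_of_real)
  then have "{Y. vect (Y * D) = vect V} = affine hull {a, a + inverse D}"
    by (simp only: affine_hull_2_alt)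
  then show ?thesis
    using assms by (simp add: aff_dim_affine_hull aff_dim_2 affine_affine_hull)
qed

text \<open>
  Multiplying by \<open>D\<close> scales all norms by \<open>|D|\<close>, and by Pythagoras the point with parameter \<open>t\<close> goes to
  a quaternion of squared norm \<open>|vect V|\<^sup>2 + t\<^sup>2\<close>.
\<close>

lemma norm_line_point_eq_iff:
  fixes D V :: quat
  assumes "D \<noteq> 0"
  shows "(norm ((vect V + of_real t) * inverse D))\<^sup>2 = r \<longleftrightarrow>
    t\<^sup>2 = r * (norm D)\<^sup>2 - (norm (vect V))\<^sup>2"
proof -
  have "(norm ((vect V + of_real t) * inverse D))\<^sup>2 = ((norm (vect V))\<^sup>2 + t\<^sup>2) / (norm D)\<^sup>2"
    by (simp add: norm_mult norm_inverse power_mult_distrib norm_vect_add_of_real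
        divide_inverse power_inverse)
  then show ?thesis
    using assms by (auto simp: field_simps)
qed

lemma sphere_inter_line:
  fixes D V :: quat
  assumes "D \<noteq> 0"
  shows "{Y. (norm Y)\<^sup>2 = r} \<inter> {Y. vect (Y * D) = vect V}
    = (\<lambda>t. (vect V + of_real t) * inverse D) ` {t. t\<^sup>2 = r * (norm D)\<^sup>2 - (norm (vect V))\<^sup>2}"
  proof -
  have "Y \<in> {Y. (norm Y)\<^sup>2 = r} \<inter> {Y. vect (Y * D) = vect V} \<longleftrightarrow>
      (\<exists>t. t\<^sup>2 = r * (norm D)\<^sup>2 - (norm (vect V))\<^sup>2 \<and> Y = (vect V + of_real t) * inverse D)" for Y
    using vect_mult_eq_iff[OF assms, of Y V] norm_line_point_eq_iff[OF assms, of V _ r] by blast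
  then show ?thesis
    by blast
qed

lemma real_square_roots:
  fixes d :: real
  shows "{t. t\<^sup>2 = d} = (if d < 0 then {} else {sqrt d, - sqrt d})"
proof -
  have "t\<^sup>2 = d \<longleftrightarrow> t = sqrt d \<or> t = - sqrt d" if "d \<ge> 0" for t
    using power2_eq_iff[of t "sqrt d"] that by simp
  moreover have "t\<^sup>2 \<noteq> d" if "d < 0" for t
    using that zero_le_power2[of t] by linarith
  ultimately show ?thesis
    by auto
qed

section \<open>The solution set\<close>

theorem theorem2:
  fixes p0 \<rho> \<Delta> :: real and Q R S T C :: quat and Sol Sph L :: "quat set"
  assumes "p0 \<noteq> 0"
    and "Sol = {X. of_real (p0 * (norm X)\<^sup>2) + X * Q + R * qcnj X = S}"
    and "\<rho> = scal S / p0 + (norm (Q + qcnj R))\<^sup>2 / (4 * p0\<^sup>2)"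
    and "C = (qcnj Q + R) /\<^sub>R (2 * p0)"
    and "T = S + (R * Q) /\<^sub>R p0"
    and "Sph = {Y. (norm Y)\<^sup>2 = \<rho>}"
    and "L = {Y. vect (Y * (Q - qcnj R)) = vect T}"
    and "\<Delta> = \<rho> * (norm (Q - qcnj R))\<^sup>2 - (norm (vect T))\<^sup>2"
  shows "Sol = {Y - C | Y. (norm Y)\<^sup>2 = \<rho> \<and> vect (Y * (Q - qcnj R)) = vect T} \<and>
    (\<rho> < 0 \<longrightarrow> Sol = {}) \<and>
    (\<rho> = 0 \<longrightarrow> (T \<in> \<real> \<longrightarrow> Sol = {- C}) \<and> (T \<notin> \<real> \<longrightarrow> Sol = {})) \<and>
    (\<rho> > 0 \<longrightarrow>
      Sph = sphere 0 (sqrt \<rho>) \<and>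
      (Q = qcnj R \<longrightarrow>
        (S \<in> \<real> \<longrightarrow> Sol = {Y - C | Y. (norm Y)\<^sup>2 = \<rho>} \<and> Sol = sphere (- C) (sqrt \<rho>)) \<and>
        (S \<notin> \<real> \<longrightarrow> Sol = {})) \<and>
      (Q \<noteq> qcnj R \<longrightarrow>
        affine L \<and> aff_dim L = 1 \<and>
        Sol = {Y - C | Y. Y \<in> Sph \<inter> L} \<and>
        (\<Delta> > 0 \<longrightarrow> card Sol = 2) \<and>
        (\<Delta> = 0 \<longrightarrow> card Sol = 1) \<and>
        (\<Delta> < 0 \<longrightarrow> Sol = {}) \<and>
        (\<Delta> \<ge> 0 \<longrightarrow>
          Sph \<inter> L = {(vect T + of_real (sqrt \<Delta>)) * inverse (Q - qcnj R),
                     (vect T - of_real (sqrt \<Delta>)) * inverse (Q - qcnj R)})))"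
proof -
  define D where "D = Q - qcnj R"
  have Sol: "Sol = {Y - C | Y. (norm Y)\<^sup>2 = \<rho> \<and> vect (Y * D) = vect T}"
  proof -
    have "X \<in> Sol \<longleftrightarrow> (norm (X + C))\<^sup>2 = \<rho> \<and> vect ((X + C) * D) = vect T" for X
      using solution_iff[OF \<open>p0 \<noteq> 0\<close>, of "X + C" Q R S, folded assms(3-5)]
      unfolding assms(2) D_def mem_Collect_eq add_diff_cancel_right' by blast
    then show ?thesis
      by (simp only: set_eq_iff mem_translate_iff) simp
  qed
  have neg: "Sol = {}" if "\<rho> < 0"
  proof -
    have "(norm Y)\<^sup>2 \<noteq> \<rho>" for Y :: quat
      using that zero_le_power2[of "norm Y"] by linarith
    then show ?thesis
      by (simp add: Sol)
  qed
  have zero: "(T \<in> \<real> \<longrightarrow> Sol = {- C}) \<and> (T \<notin> \<real> \<longrightarrow> Sol = {})" if "\<rho> = 0"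
  proof -
    have "vect (0 :: quat) = 0"
      by (simp add: quat_eq_iff)
    then show ?thesis
      using that by (auto simp: Sol quat_Reals_iff)
  qed
  have norm_sq: "(norm Y)\<^sup>2 = \<rho> \<longleftrightarrow> norm Y = sqrt \<rho>" if "\<rho> > 0" for Y :: quat
    using that by (metis norm_ge_zero real_sqrt_pow2 real_sqrt_unique less_imp_le)
  have sph: "Sph = sphere 0 (sqrt \<rho>)" if "\<rho> > 0"
    unfolding assms(6) set_eq_iff mem_Collect_eq mem_sphere_0 using norm_sq[OF that] by blast
  have degenerate: "(S \<in> \<real> \<longrightarrow> Sol = {Y - C | Y. (norm Y)\<^sup>2 = \<rho>} \<and> Sol = sphere (- C) (sqrt \<rho>)) \<and>
      (S \<notin> \<real> \<longrightarrow> Sol = {})" if "\<rho> > 0" "Q = qcnj R"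
  proof -
    have "D = 0"
      using that by (simp add: D_def)
    \<comment> \<open>Here \<open>R Q = |R|\<^sup>2\<close> is real, so that \<open>T\<close> and \<open>S\<close> have the same vector part.\<close>
    have "vect T = vect S"
      unfolding assms(5) \<open>Q = qcnj R\<close> mult_qcnj by (simp add: quat_eq_iff del: of_real_power)
    moreover have "vect (0 :: quat) = 0"
      by (simp add: quat_eq_iff)
    ultimately have Sol': "Sol = (if S \<in> \<real> then {Y - C | Y. (norm Y)\<^sup>2 = \<rho>} else {})"
      using \<open>D = 0\<close> by (auto simp: Sol quat_Reals_iff)
    have "{Y - C | Y. (norm Y)\<^sup>2 = \<rho>} = sphere (- C) (sqrt \<rho>)"
    proof -
      have "X \<in> {Y - C | Y. (norm Y)\<^sup>2 = \<rho>} \<longleftrightarrow> norm (X + C) = sqrt \<rho>" for X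
        unfolding mem_translate_iff using norm_sq[OF \<open>\<rho> > 0\<close>] .
      moreover have "X \<in> sphere (- C) (sqrt \<rho>) \<longleftrightarrow> norm (X + C) = sqrt \<rho>" for X
        by (simp add: dist_norm norm_minus_commute[of "- C"])
      ultimately show ?thesis
        by blast
    qed
    with Sol' show ?thesis
      by simp
  qed
  have regular: "affine L \<and> aff_dim L = 1 \<and>
      Sol = {Y - C | Y. Y \<in> Sph \<inter> L} \<and>
      (\<Delta> > 0 \<longrightarrow> card Sol = 2) \<and>
      (\<Delta> = 0 \<longrightarrow> card Sol = 1) \<and>
      (\<Delta> < 0 \<longrightarrow> Sol = {}) \<and>
      (\<Delta> \<ge> 0 \<longrightarrow>
        Sph \<inter> L = {(vect T + of_real (sqrt \<Delta>)) * inverse D, (vect T - of_real (sqrt \<Delta>)) * inverse D})"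
    if "Q \<noteq> qcnj R"
  proof -
    have "D \<noteq> 0"
      using that by (simp add: D_def)
    have L: "L = {Y. vect (Y * D) = vect T}"
      using assms(7) by (simp add: D_def)
    have line: "affine L \<and> aff_dim L = 1"
      unfolding L by (rule vect_mult_line[OF \<open>D \<noteq> 0\<close>])
    have SolC: "Sol = {Y - C | Y. Y \<in> Sph \<inter> L}"
      by (simp add: Sol L assms(6))
    then have "Sol = (\<lambda>Y. Y - C) ` (Sph \<inter> L)"
      by blast
    moreover have "inj_on (\<lambda>Y. Y - C) (Sph \<inter> L)"
      by (simp add: inj_on_def)
    ultimately have card_Sol: "card Sol = card (Sph \<inter> L)"
      by (simp add: card_image)
    have "\<rho> * (norm D)\<^sup>2 - (norm (vect T))\<^sup>2 = \<Delta>"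
      using assms(8) by (simp add: D_def)
    then have inter: "Sph \<inter> L = (\<lambda>t. (vect T + of_real t) * inverse D) ` {t. t\<^sup>2 = \<Delta>}"
      using sphere_inter_line[OF \<open>D \<noteq> 0\<close>, of \<rho> T] by (simp add: L assms(6))
    have "inj (\<lambda>t. (vect T + of_real t) * inverse D)"
      using \<open>D \<noteq> 0\<close> by (simp add: inj_def)
    then have "card (Sph \<inter> L) = card {t. t\<^sup>2 = \<Delta>}"
      unfolding inter by (metis card_image inj_on_subset subset_UNIV)
    then have "card Sol = card {t. t\<^sup>2 = \<Delta>}"
      using card_Sol by simp
    then have "\<Delta> > 0 \<longrightarrow> card Sol = 2" "\<Delta> = 0 \<longrightarrow> card Sol = 1"
      by (simp_all add: real_square_roots)
    moreover have "\<Delta> < 0 \<longrightarrow> Sol = {}"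
      using SolC by (simp add: inter real_square_roots)
    moreover have "\<Delta> \<ge> 0 \<longrightarrow>
        Sph \<inter> L = {(vect T + of_real (sqrt \<Delta>)) * inverse D, (vect T - of_real (sqrt \<Delta>)) * inverse D}"
      by (simp add: inter real_square_roots)
    ultimately show ?thesis
      using line SolC by blast
  qed
  show ?thesis
    unfolding D_def[symmetric]
    by (rule conjI, rule Sol, rule conjI, rule impI, erule neg, rule conjI, rule impI, erule zero,
        rule impI, rule conjI, erule sph, rule conjI, rule impI, erule (1) degenerate,
        rule impI, erule regular)
qed

end
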